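(* Let $m\geq 2$ be an integer and let $\mathbf{q}=(2,1,2,\dots,2)\in[1,2]^m$ (that is, $q_2=1$ and $q_i=2$ for all $i\neq 2$). Then the optimal constant of the mixed $(\ell_1,\ell_2)$-Littlewood-type inequality with exponent $\mathbf{q}$ for real scalars is $$C_{m,(2,1,2,\dots,2)}^{\mathbb{R}}=2^{\frac{m-1}{2}}.$$
   Context: Let $c_0$ be the real Banach space of real null sequences with the supremum norm, with canonical unit vectors $(e_j)_{j\ge1}$, and for a continuous $m$-linear form $T:c_0\times\cdots\times c_0\to\mathbb{R}$ put $\|T\|=\sup\{|T(z_1,\dots,z_m)|:\|z_k\|\le 1,\ k=1,\dots,m\}$. For $\mathbf{q}=(q_1,\dots,q_m)\in[1,2]^m$, $C_{m,\mathbf{q}}^{\mathbb{R}}$ denotes the optimal (smallest) constant $C$ such that $$\left(\sum_{j_1=1}^{N}\left(\sum_{j_2=1}^{N}\left(\cdots\left(\sum_{j_m=1}^{N}\left|T(e_{j_1},\dots,e_{j_m})\right|^{q_m}\right)^{\frac{q_{m-1}}{q_m}}\cdots\right)^{\frac{q_2}{q_3}}\right)^{\frac{q_1}{q_2}}\right)^{\frac{1}{q_1}}\leq C\,\|T\|$$ for all continuous $m$-linear forms $T:c_0\times\cdots\times c_0\to\mathbb{R}$ and all positive integers $N$. *)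

theory Defs
  imports "HOL-Analysis.Analysis"
begin

typedef c0 = "{x :: nat \<Rightarrow> real. x \<longlonglongrightarrow> 0}"
  morphisms c0_nth Abs_c0
  by (rule exI[of _ "\<lambda>_. 0"]) simp

setup_lifting type_definition_c0

lemma c0_eqI: "(\<And>j. c0_nth x j = c0_nth y j) \<Longrightarrow> x = y"
  by (simp add: c0_nth_inject[symmetric] fun_eq_iff)

instantiation c0 :: real_vector
begin

lift_definition zero_c0 :: c0 is "\<lambda>_. 0" by simp
lift_definition plus_c0 :: "c0 \<Rightarrow> c0 \<Rightarrow> c0" is "\<lambda>x y j. x j + y j"
  using tendsto_add[of _ "0::real" _ _ "0::real"] by fastforce
lift_definition minus_c0 :: "c0 \<Rightarrow> c0 \<Rightarrow> c0" is "\<lambda>x y j. x j - y j"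
  using tendsto_diff[of _ "0::real" _ _ "0::real"] by fastforce
lift_definition uminus_c0 :: "c0 \<Rightarrow> c0" is "\<lambda>x j. - x j"
  using tendsto_minus[of _ "0::real"] by fastforce
lift_definition scaleR_c0 :: "real \<Rightarrow> c0 \<Rightarrow> c0" is "\<lambda>r x j. r * x j"
  by (rule tendsto_mult_right_zero)

instance
  by standard (transfer, simp add: fun_eq_iff algebra_simps)+

end

lemmas c0_nth_simps [simp] =
  zero_c0.rep_eq plus_c0.rep_eq minus_c0.rep_eq uminus_c0.rep_eq scaleR_c0.rep_eq

lemma c0_nth_tendsto: "c0_nth x \<longlonglongrightarrow> 0"
  using c0_nth[of x] by simp

lemma c0_bdd_above: "bdd_above (range (\<lambda>j. \<bar>c0_nth x j\<bar>))"
proof -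
  have "Bseq (c0_nth x)"
    using c0_nth_tendsto convergentI convergent_imp_Bseq by blast
  then show ?thesis
    by (auto simp: Bseq_def bdd_above_def)
qed

instantiation c0 :: real_normed_vector
begin

definition norm_c0 :: "c0 \<Rightarrow> real" where
  "norm_c0 x = (SUP j. \<bar>c0_nth x j\<bar>)"
definition dist_c0 :: "c0 \<Rightarrow> c0 \<Rightarrow> real" where
  "dist_c0 x y = norm (x - y)"
definition sgn_c0 :: "c0 \<Rightarrow> c0" where
  "sgn_c0 x = x /\<^sub>R norm x"
definition uniformity_c0 :: "(c0 \<times> c0) filter" where
  "uniformity_c0 = (INF e\<in>{0 <..}. principal {(x, y). dist x y < e})"
definition open_c0 :: "c0 set \<Rightarrow> bool" where
  "open_c0 U \<longleftrightarrow> (\<forall>x\<in>U. \<forall>\<^sub>F (x', y) in uniformity. x' = x \<longrightarrow> y \<in> U)"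

instance
proof
  have nth_le: "\<bar>c0_nth x j\<bar> \<le> norm x" for x j
    unfolding norm_c0_def by (intro cSUP_upper c0_bdd_above) simp
  have le: "norm x \<le> B" if "\<And>j. \<bar>c0_nth x j\<bar> \<le> B" for x B
    unfolding norm_c0_def using that by (intro cSUP_least) auto
  fix x y :: c0 and r :: real
  show "norm x = 0 \<longleftrightarrow> x = 0"
  proof
    assume "norm x = 0"
    then show "x = 0" using nth_le[of x] by (intro c0_eqI) simp
  qed (simp add: norm_c0_def)
  show "norm (x + y) \<le> norm x + norm y"
  proof (rule le)
    fix j show "\<bar>c0_nth (x + y) j\<bar> \<le> norm x + norm y"
      using nth_le[of x j] nth_le[of y j] by simp
  qed
  show "norm (r *\<^sub>R x) = \<bar>r\<bar> * norm x"
  proof (rule antisym)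
    show up: "norm (r *\<^sub>R x) \<le> \<bar>r\<bar> * norm x"
      by (rule le) (simp add: abs_mult mult_left_mono nth_le)
    show "\<bar>r\<bar> * norm x \<le> norm (r *\<^sub>R x)"
    proof (cases "r = 0")
      case True
      then show ?thesis using nth_le[of "r *\<^sub>R x" 0] by simp
    next
      case False
      have "norm x \<le> norm (r *\<^sub>R x) / \<bar>r\<bar>"
        using nth_le[of "r *\<^sub>R x"] False
        by (intro le) (simp add: field_simps abs_mult)
      then show ?thesis using False by (simp add: field_simps)
    qed
  qed
qed (simp_all add: dist_c0_def sgn_c0_def uniformity_c0_def open_c0_def)

end

lemma c0_nth_le_norm: "\<bar>c0_nth x j\<bar> \<le> norm x"
  unfolding norm_c0_def by (intro cSUP_upper c0_bdd_above) simp

lemma c0_norm_le: "(\<And>j. \<bar>c0_nth x j\<bar> \<le> B) \<Longrightarrow> norm x \<le> B"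
  unfolding norm_c0_def by (intro cSUP_least) auto

instance c0 :: banach
proof
  fix X :: "nat \<Rightarrow> c0"
  assume X: "Cauchy X"
  have dist_nth: "dist (c0_nth x j) (c0_nth y j) \<le> dist x y" for x y j
    using c0_nth_le_norm[of "x - y" j] by (simp add: dist_norm)
  have "uniformly_Cauchy_on UNIV (\<lambda>n. c0_nth (X n))"
    unfolding uniformly_Cauchy_on_def
  proof (intro allI impI)
    fix e :: real assume "e > 0"
    then obtain M where "\<forall>m\<ge>M. \<forall>n\<ge>M. dist (X m) (X n) < e"
      using X unfolding Cauchy_def by blast
    then show "\<exists>M. \<forall>j\<in>UNIV. \<forall>m\<ge>M. \<forall>n\<ge>M. dist (c0_nth (X m) j) (c0_nth (X n) j) < e"
      using dist_nth le_less_trans by blast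
  qed
  then obtain l where l: "uniform_limit UNIV (\<lambda>n. c0_nth (X n)) l sequentially"
    using uniformly_convergent_eq_Cauchy Cauchy_uniformly_convergent
      uniformly_convergent_on_def by blast
  have "l \<longlonglongrightarrow> 0"
    by (rule swap_uniform_limit'[OF _ tendsto_const l])
      (auto simp: c0_nth_tendsto)
  then have nth_l: "c0_nth (Abs_c0 l) = l"
    by (simp add: Abs_c0_inverse)
  have "X \<longlonglongrightarrow> Abs_c0 l"
  proof (rule metric_LIMSEQ_I)
    fix e :: real assume "e > 0"
    then obtain M where M: "\<forall>n\<ge>M. \<forall>j. dist (c0_nth (X n) j) (l j) < e / 2"
      using uniform_limitD[OF l, of "e / 2"] by (auto simp: eventually_sequentially)
    have "dist (X n) (Abs_c0 l) < e" if "n \<ge> M" for n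
    proof -
      have "norm (X n - Abs_c0 l) \<le> e / 2"
        using M that by (intro c0_norm_le) (auto simp: nth_l dist_real_def less_imp_le)
      then show ?thesis using \<open>e > 0\<close> by (simp add: dist_norm)
    qed
    then show "\<exists>M. \<forall>n\<ge>M. dist (X n) (Abs_c0 l) < e" by blast
  qed
  then show "convergent X" by (rule convergentI)
qed

text \<open>Coordinates are numbered from 0, so \<open>c0_unit j\<close> is \<open>e\<^sub>j\<^sub>+\<^sub>1\<close> when sequences are
  numbered from 1, and sums over \<open>1, \<dots>, N\<close> become sums over \<open>j < N\<close>.\<close>

lift_definition c0_unit :: "nat \<Rightarrow> c0" is "\<lambda>j i. if i = j then 1 else 0"
proof -
  fix j :: nat
  have "\<forall>\<^sub>F i in sequentially. (if i = j then 1 else 0 :: real) = 0"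
    using eventually_gt_at_top[of j] by eventually_elim simp
  then show "(\<lambda>i. if i = j then 1 else 0 :: real) \<longlonglongrightarrow> 0"
    by (rule tendsto_eventually)
qed

text \<open>A point of \<open>X \<times> \<dots> \<times> X\<close> (\<open>m\<close> factors) is an element of
  \<open>{..<m} \<rightarrow>\<^sub>E UNIV\<close>; the values of a form outside this set are irrelevant.\<close>

definition multilinear_form :: "nat \<Rightarrow> ((nat \<Rightarrow> 'a::real_vector) \<Rightarrow> real) \<Rightarrow> bool" where
  "multilinear_form m T \<longleftrightarrow>
     (\<forall>z \<in> {..<m} \<rightarrow>\<^sub>E UNIV. \<forall>k<m. linear (\<lambda>x. T (z(k := x))))"

definition continuous_multilinear_form ::
    "nat \<Rightarrow> ((nat \<Rightarrow> 'a::real_normed_vector) \<Rightarrow> real) \<Rightarrow> bool" where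
  "continuous_multilinear_form m T \<longleftrightarrow>
     multilinear_form m T \<and>
     continuous_map (product_topology (\<lambda>_. euclidean) {..<m}) euclidean T"

definition form_norm :: "nat \<Rightarrow> ((nat \<Rightarrow> 'a::real_normed_vector) \<Rightarrow> real) \<Rightarrow> real" where
  "form_norm m T = (SUP z \<in> {..<m} \<rightarrow>\<^sub>E cball 0 1. \<bar>T z\<bar>)"

text \<open>For \<open>q = [q\<^sub>1, \<dots>, q\<^sub>m]\<close> the nested sum is everything inside the outermost power
  \<open>1 / q\<^sub>1\<close>; the array \<open>a\<close> is indexed by the list \<open>[j\<^sub>1, \<dots>, j\<^sub>m]\<close>.
  The value for the empty list of exponents is a convention that is never used.\<close>

fun nested_sum :: "real list \<Rightarrow> nat \<Rightarrow> (nat list \<Rightarrow> real) \<Rightarrow> real" where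
  "nested_sum [] N a = \<bar>a []\<bar>"
| "nested_sum [q] N a = (\<Sum>j<N. \<bar>a [j]\<bar> powr q)"
| "nested_sum (q # r # qs) N a =
     (\<Sum>j<N. nested_sum (r # qs) N (\<lambda>js. a (j # js)) powr (q / r))"

definition mixed_norm :: "real list \<Rightarrow> nat \<Rightarrow> (nat list \<Rightarrow> real) \<Rightarrow> real" where
  "mixed_norm q N a = nested_sum q N a powr (1 / hd q)"

definition littlewood_constant :: "nat \<Rightarrow> real list \<Rightarrow> real \<Rightarrow> bool" where
  "littlewood_constant m q C \<longleftrightarrow>
     (\<forall>T N. continuous_multilinear_form m T \<longrightarrow> 0 < N \<longrightarrow>
        mixed_norm q N (\<lambda>js. T (\<lambda>k\<in>{..<m}. c0_unit (js ! k))) \<le> C * form_norm m T)"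

text \<open>A predicate rather than a \<open>LEAST\<close> or \<open>Inf\<close> term, so that the existence of a
  smallest constant is asserted too.\<close>

definition optimal_littlewood_constant :: "nat \<Rightarrow> real list \<Rightarrow> real \<Rightarrow> bool" where
  "optimal_littlewood_constant m q C \<longleftrightarrow>
     littlewood_constant m q C \<and> (\<forall>C'. littlewood_constant m q C' \<longrightarrow> C \<le> C')"

end

theory Submission
  imports Defs
begin

text \<open>The upper bound rests on the Khinchine-Kahane inequality with the optimal constant \<open>sqrt 2\<close>:
  for vectors of a Euclidean space, the root of the sum of the squared norms is at most \<open>sqrt 2\<close>
  times the mean norm of their signed sums (\<open>khinchine_kahane_L2\<close>). It is derived as by Latala
  and Oleszkiewicz: the norm of the signed sum is an even function on the discrete cube, its
  Dirichlet energy is at most its mean square by the triangle inequality, and for even functions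
  the Poincare inequality holds with a constant twice as good as in general
  (\<open>two_variance_le_energies\<close>).

  Given a form \<open>T\<close>, Minkowski's inequality moves the sum over the second index, the one with
  exponent 1, to the outside. The remaining \<open>m - 1\<close> indices all carry the exponent 2, and they are
  removed one at a time: the signs provided by the inequality are the entries of a unit vector of
  \<open>c\<^sub>0\<close>, at which \<open>T\<close> is then evaluated (\<open>exists_point_for_L2_sums\<close>). This costs a factor \<open>sqrt 2\<close> per
  index, hence \<open>2 powr ((m - 1) / 2)\<close> in total, and leaves the sum of the absolute values of \<open>T\<close>
  along the unit vectors in the second coordinate, which is at most the norm of \<open>T\<close>.

  For the lower bound, let the second index run over all sign patterns \<open>s\<close> on the other \<open>m - 1\<close>
  coordinates, and let its coefficient be the product of the linear forms \<open>x\<^sub>k 0 + s\<^sub>k x\<^sub>k 1\<close>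
  (\<open>sign_form\<close>). The absolute values of these products sum up to the product of the numbers
  \<open>\<bar>x\<^sub>k 0 + x\<^sub>k 1\<bar> + \<bar>x\<^sub>k 0 - x\<^sub>k 1\<bar> \<le> 2\<close>, so the norm is at most \<open>2 ^ (m - 1)\<close>, whereas the mixed
  norm of the coefficients, which are \<open>1\<close>, \<open>-1\<close> or \<open>0\<close>, is \<open>2 ^ (m - 1) * sqrt 2 ^ (m - 1)\<close>
  (\<open>mixed_norm_sign_form\<close>).\<close>

section \<open>Functions on the discrete cube\<close>

text \<open>The cube \<open>{-1, 1}\<close> to the power \<open>A\<close> is encoded as \<open>Pow A\<close>: the set \<open>X\<close> stands for the
  point whose coordinates \<open>+1\<close> are those in \<open>X\<close>. The opposite point is then \<open>A - X\<close>.\<close>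

definition cube_mean :: "'a set \<Rightarrow> ('a set \<Rightarrow> real) \<Rightarrow> real" where
  "cube_mean A f = (\<Sum>X\<in>Pow A. f X) / 2 ^ card A"

definition flip :: "'a \<Rightarrow> 'a set \<Rightarrow> 'a set" where
  "flip i X = (if i \<in> X then X - {i} else insert i X)"

definition cube_sign :: "'a set \<Rightarrow> 'a \<Rightarrow> real" where
  "cube_sign X i = (if i \<in> X then 1 else -1)"

text \<open>In terms of the Fourier-Walsh coefficients of \<open>f\<close>, this is the sum of the squares of the
  coefficients of the characters, each weighted with the degree of its character.\<close>

definition cube_energy :: "'a set \<Rightarrow> ('a set \<Rightarrow> real) \<Rightarrow> real" where
  "cube_energy A f = (\<Sum>i\<in>A. cube_mean A (\<lambda>X. (f X - f (flip i X))\<^sup>2)) / 4"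

text \<open>The mean square of the odd part \<open>(f X - f (A - X)) / 2\<close>, hence in Fourier terms the sum of the
  squares of the coefficients of odd degree.\<close>

definition odd_energy :: "'a set \<Rightarrow> ('a set \<Rightarrow> real) \<Rightarrow> real" where
  "odd_energy A f = cube_mean A (\<lambda>X. (f X - f (A - X))\<^sup>2) / 4"

lemma cube_mean_cong: "(\<And>X. X \<subseteq> A \<Longrightarrow> f X = g X) \<Longrightarrow> cube_mean A f = cube_mean A g"
  by (simp add: cube_mean_def)

lemma cube_mean_mono: "(\<And>X. X \<subseteq> A \<Longrightarrow> f X \<le> g X) \<Longrightarrow> cube_mean A f \<le> cube_mean A g"
  unfolding cube_mean_def by (intro divide_right_mono sum_mono) auto

lemma cube_mean_nonneg: "(\<And>X. X \<subseteq> A \<Longrightarrow> 0 \<le> f X) \<Longrightarrow> 0 \<le> cube_mean A f"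
  unfolding cube_mean_def by (intro divide_nonneg_nonneg sum_nonneg) auto

lemma cube_mean_add: "cube_mean A (\<lambda>X. f X + g X) = cube_mean A f + cube_mean A g"
  by (simp add: cube_mean_def sum.distrib add_divide_distrib)

lemma cube_mean_diff: "cube_mean A (\<lambda>X. f X - g X) = cube_mean A f - cube_mean A g"
  by (simp add: cube_mean_def sum_subtractf diff_divide_distrib)

lemma cube_mean_cmult: "cube_mean A (\<lambda>X. c * f X) = c * cube_mean A f"
  by (simp add: cube_mean_def flip: sum_distrib_left)

lemma cube_mean_sum: "cube_mean A (\<lambda>X. \<Sum>i\<in>I. f i X) = (\<Sum>i\<in>I. cube_mean A (f i))"
  unfolding cube_mean_def by (subst sum.swap) (simp add: sum_divide_distrib)

lemma cube_mean_const: "finite A \<Longrightarrow> cube_mean A (\<lambda>X. c) = c"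
  by (simp add: cube_mean_def card_Pow)

lemma cube_mean_empty: "cube_mean {} f = f {}"
  by (simp add: cube_mean_def)

lemma cube_mean_insert:
  assumes "finite A" "a \<notin> A"
  shows "cube_mean (insert a A) f = cube_mean A (\<lambda>X. (f X + f (insert a X)) / 2)"
proof -
  have inj: "inj_on (insert a) (Pow A)"
    using assms(2) by (auto simp: inj_on_def insert_ident)
  have "(\<Sum>X\<in>Pow (insert a A). f X) = (\<Sum>X\<in>Pow A. f X) + (\<Sum>X\<in>insert a ` Pow A. f X)"
    unfolding Pow_insert using assms by (intro sum.union_disjoint) auto
  also have "\<dots> = (\<Sum>X\<in>Pow A. f X + f (insert a X))"
    using inj by (simp add: sum.reindex sum.distrib)
  finally show ?thesis
    using assms by (simp add: cube_mean_def flip: sum_divide_distrib)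
qed

lemma cube_mean_compl: "cube_mean A (\<lambda>X. f (A - X)) = cube_mean A f"
proof -
  have "bij_betw (\<lambda>X. A - X) (Pow A) (Pow A)"
    by (rule bij_betw_byWitness[where f' = "\<lambda>X. A - X"]) auto
  from sum.reindex_bij_betw[OF this, of f] show ?thesis
    by (simp add: cube_mean_def)
qed

lemma cube_mean_flip:
  assumes "i \<in> A"
  shows "cube_mean A (\<lambda>X. f (flip i X)) = cube_mean A f"
proof -
  have "bij_betw (flip i) (Pow A) (Pow A)"
    by (rule bij_betw_byWitness[where f' = "flip i"])
      (use assms in \<open>auto simp: flip_def\<close>)
  from sum.reindex_bij_betw[OF this, of f] show ?thesis
    by (simp add: cube_mean_def)
qed

text \<open>With respect to the coordinate \<open>a\<close>, the function splits as \<open>f = u - x\<^sub>a v\<close>, with \<open>u\<close> and \<open>v\<close> on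
  the smaller cube. The two parts are orthogonal; multiplication by \<open>x\<^sub>a\<close> raises each degree
  by one, which costs the additional mean square of \<open>v\<close>.\<close>

lemma cube_energy_insert:
  fixes f :: "'a set \<Rightarrow> real"
  assumes A: "finite A" "a \<notin> A"
    and u_def: "\<And>X. u X = (f X + f (insert a X)) / 2"
    and v_def: "\<And>X. v X = (f X - f (insert a X)) / 2"
  shows "cube_energy (insert a A) f
       = cube_energy A u + cube_energy A v + cube_mean A (\<lambda>X. (v X)\<^sup>2)"
proof -
  have "cube_mean (insert a A) (\<lambda>X. (f X - f (flip a X))\<^sup>2) = cube_mean A (\<lambda>X. 4 * (v X)\<^sup>2)"
    unfolding cube_mean_insert[OF A]
  proof (rule cube_mean_cong)
    fix X assume "X \<subseteq> A"
    then have "flip a X = insert a X" "flip a (insert a X) = X"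
      using A by (auto simp: flip_def)
    then show "((f X - f (flip a X))\<^sup>2 + (f (insert a X) - f (flip a (insert a X)))\<^sup>2) / 2
        = 4 * (v X)\<^sup>2"
      by (simp add: v_def power2_eq_square field_simps)
  qed
  moreover have "cube_mean (insert a A) (\<lambda>X. (f X - f (flip i X))\<^sup>2)
      = cube_mean A (\<lambda>X. (u X - u (flip i X))\<^sup>2) + cube_mean A (\<lambda>X. (v X - v (flip i X))\<^sup>2)"
    if "i \<in> A" for i
    unfolding cube_mean_insert[OF A] cube_mean_add[symmetric]
  proof (rule cube_mean_cong)
    fix X assume "X \<subseteq> A"
    then have "flip i (insert a X) = insert a (flip i X)"
      using A that by (auto simp: flip_def)
    then show "((f X - f (flip i X))\<^sup>2 + (f (insert a X) - f (flip i (insert a X)))\<^sup>2) / 2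
        = (u X - u (flip i X))\<^sup>2 + (v X - v (flip i X))\<^sup>2"
      by (simp add: u_def v_def power2_eq_square field_simps)
  qed
  ultimately show ?thesis
    using A by (simp add: cube_energy_def sum.distrib cube_mean_cmult add_divide_distrib)
qed

text \<open>The odd part of \<open>u - x\<^sub>a v\<close> consists of the odd part of \<open>u\<close> and the even part of \<open>v\<close>. The
  mean square of the even part of \<open>v\<close> is that of \<open>v\<close> minus its odd energy.\<close>

lemma odd_energy_insert:
  fixes f :: "'a set \<Rightarrow> real"
  assumes A: "finite A" "a \<notin> A"
    and u_def: "\<And>X. u X = (f X + f (insert a X)) / 2"
    and v_def: "\<And>X. v X = (f X - f (insert a X)) / 2"
  shows "odd_energy (insert a A) f + odd_energy A v
       = odd_energy A u + cube_mean A (\<lambda>X. (v X)\<^sup>2)"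
proof -
  have "cube_mean (insert a A) (\<lambda>X. (f X - f (insert a A - X))\<^sup>2)
      = cube_mean A (\<lambda>X. (u X - u (A - X))\<^sup>2) + cube_mean A (\<lambda>X. (v X + v (A - X))\<^sup>2)"
    unfolding cube_mean_insert[OF A] cube_mean_add[symmetric]
  proof (rule cube_mean_cong)
    fix X assume "X \<subseteq> A"
    then have "insert a A - X = insert a (A - X)" "insert a A - insert a X = A - X"
      using A by auto
    then show "((f X - f (insert a A - X))\<^sup>2 + (f (insert a X) - f (insert a A - insert a X))\<^sup>2) / 2
        = (u X - u (A - X))\<^sup>2 + (v X + v (A - X))\<^sup>2"
      by (simp add: u_def v_def power2_eq_square field_simps)
  qed
  moreover have "cube_mean A (\<lambda>X. (v X + v (A - X))\<^sup>2) + cube_mean A (\<lambda>X. (v X - v (A - X))\<^sup>2)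
      = 2 * cube_mean A (\<lambda>X. (v X)\<^sup>2) + 2 * cube_mean A (\<lambda>X. (v (A - X))\<^sup>2)"
    unfolding cube_mean_add[symmetric] cube_mean_cmult[symmetric]
    by (intro cube_mean_cong) (simp add: power2_eq_square field_simps)
  moreover have "cube_mean A (\<lambda>X. (v (A - X))\<^sup>2) = cube_mean A (\<lambda>X. (v X)\<^sup>2)"
    by (rule cube_mean_compl)
  ultimately show ?thesis
    unfolding odd_energy_def by linarith
qed

text \<open>In Fourier terms, an odd degree is at least one. The induction over the coordinates replaces
  the Fourier expansion.\<close>

lemma odd_energy_le_cube_energy:
  "finite A \<Longrightarrow> odd_energy A f \<le> cube_energy A f"
proof (induction A arbitrary: f rule: finite_induct)
  case empty
  then show ?case by (simp add: odd_energy_def cube_energy_def cube_mean_empty)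
next
  case (insert a A)
  define u v where u: "u X = (f X + f (insert a X)) / 2"
    and v: "v X = (f X - f (insert a X)) / 2" for X
  have "0 \<le> cube_energy A v" "0 \<le> odd_energy A v"
    by (auto simp: cube_energy_def odd_energy_def intro!: sum_nonneg cube_mean_nonneg)
  then show ?case
    using cube_energy_insert[where f = f and u = u and v = v, OF insert.hyps u v]
      odd_energy_insert[where f = f and u = u and v = v, OF insert.hyps u v]
      insert.IH[of u] by linarith
qed

text \<open>A nonzero degree, increased by one if it is odd, is at least two. For an even function the odd
  energy vanishes, so that the Poincare inequality improves by the factor two.\<close>

lemma two_variance_le_energies:
  "finite A \<Longrightarrow>
   2 * (cube_mean A (\<lambda>X. (f X)\<^sup>2) - (cube_mean A f)\<^sup>2) \<le> cube_energy A f + odd_energy A f"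
proof (induction A arbitrary: f rule: finite_induct)
  case empty
  then show ?case by (simp add: odd_energy_def cube_energy_def cube_mean_empty)
next
  case (insert a A)
  define u v where u: "u X = (f X + f (insert a X)) / 2"
    and v: "v X = (f X - f (insert a X)) / 2" for X
  have "cube_mean (insert a A) (\<lambda>X. (f X)\<^sup>2)
      = cube_mean A (\<lambda>X. (u X)\<^sup>2) + cube_mean A (\<lambda>X. (v X)\<^sup>2)"
    unfolding cube_mean_insert[OF insert.hyps] cube_mean_add[symmetric]
    by (intro cube_mean_cong) (simp add: u v power2_eq_square field_simps)
  moreover have "(cube_mean (insert a A) f)\<^sup>2 = (cube_mean A u)\<^sup>2"
    by (simp only: cube_mean_insert[OF insert.hyps] u[symmetric])
  ultimately show ?case
    using cube_energy_insert[where f = f and u = u and v = v, OF insert.hyps u v]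
      odd_energy_insert[where f = f and u = u and v = v, OF insert.hyps u v]
      insert.IH[of u] odd_energy_le_cube_energy[OF insert.hyps(1), of v]
    by (simp add: algebra_simps)
qed

text \<open>The argument of Latala and Oleszkiewicz. The bound on the sum over the neighbours of a point
  says that the energy is at most the mean square. Since \<open>f\<close> is even, the energy is also at
  least twice the variance, and comparing the two bounds gives the claim.\<close>

lemma mean_square_le_two_square_mean:
  fixes f :: "'a set \<Rightarrow> real"
  assumes "finite A"
    and nonneg: "\<And>X. X \<subseteq> A \<Longrightarrow> 0 \<le> f X"
    and even: "\<And>X. X \<subseteq> A \<Longrightarrow> f (A - X) = f X"
    and flips: "\<And>X. X \<subseteq> A \<Longrightarrow> (real (card A) - 2) * f X \<le> (\<Sum>i\<in>A. f (flip i X))"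
  shows "cube_mean A (\<lambda>X. (f X)\<^sup>2) \<le> 2 * (cube_mean A f)\<^sup>2"
proof -
  let ?M = "cube_mean A (\<lambda>X. (f X)\<^sup>2)"
  \<comment> \<open>The odd energy of an even function vanishes.\<close>
  have "odd_energy A f = cube_mean A (\<lambda>X. 0) / 4"
    unfolding odd_energy_def by (subst cube_mean_cong[where g = "\<lambda>X. 0"]) (auto simp: even)
  then have odd: "odd_energy A f = 0"
    by (simp add: cube_mean_def)
  have "cube_mean A (\<lambda>X. (f X - f (flip i X))\<^sup>2) = 2 * ?M - 2 * cube_mean A (\<lambda>X. f X * f (flip i X))"
    if "i \<in> A" for i
  proof -
    have "cube_mean A (\<lambda>X. (f X - f (flip i X))\<^sup>2)
        = cube_mean A (\<lambda>X. ((f X)\<^sup>2 + (f (flip i X))\<^sup>2) - 2 * (f X * f (flip i X)))"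
      by (intro cube_mean_cong) (simp add: power2_eq_square field_simps)
    also have "\<dots> = ?M + cube_mean A (\<lambda>X. (f (flip i X))\<^sup>2) - 2 * cube_mean A (\<lambda>X. f X * f (flip i X))"
      by (simp only: cube_mean_diff cube_mean_add cube_mean_cmult)
    also have "cube_mean A (\<lambda>X. (f (flip i X))\<^sup>2) = ?M"
      by (rule cube_mean_flip[OF that])
    finally show ?thesis by simp
  qed
  then have "4 * cube_energy A f
      = real (card A) * (2 * ?M) - 2 * (\<Sum>i\<in>A. cube_mean A (\<lambda>X. f X * f (flip i X)))"
    by (simp add: cube_energy_def sum_subtractf flip: sum_distrib_left)
  also have "(\<Sum>i\<in>A. cube_mean A (\<lambda>X. f X * f (flip i X)))
      = cube_mean A (\<lambda>X. f X * (\<Sum>i\<in>A. f (flip i X)))"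
    by (simp add: cube_mean_sum[symmetric] sum_distrib_left)
  finally have energy: "4 * cube_energy A f
      = real (card A) * (2 * ?M) - 2 * cube_mean A (\<lambda>X. f X * (\<Sum>i\<in>A. f (flip i X)))" .
  \<comment> \<open>Weighting the hypothesis on neighbours with \<open>f X\<close> bounds the correlation of \<open>f\<close> with its flips.\<close>
  have "(real (card A) - 2) * ?M = cube_mean A (\<lambda>X. (real (card A) - 2) * (f X)\<^sup>2)"
    by (rule cube_mean_cmult[symmetric])
  also have "\<dots> \<le> cube_mean A (\<lambda>X. f X * (\<Sum>i\<in>A. f (flip i X)))"
  proof (rule cube_mean_mono)
    fix X assume "X \<subseteq> A"
    from mult_left_mono[OF flips[OF this] nonneg[OF this]]
    show "(real (card A) - 2) * (f X)\<^sup>2 \<le> f X * (\<Sum>i\<in>A. f (flip i X))"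
      by (simp add: power2_eq_square algebra_simps)
  qed
  finally have "cube_energy A f \<le> ?M"
    using energy by (simp add: algebra_simps)
  then show ?thesis
    using two_variance_le_energies[OF \<open>finite A\<close>, of f] odd by simp
qed

section \<open>The Khinchine-Kahane inequality in Euclidean space\<close>

text \<open>Distinct sign coordinates are orthogonal. The constant \<open>s\<close> makes the induction work: it absorbs
  the summand of the coordinate that is split off.\<close>

lemma mean_square_signed_sum:
  "finite A \<Longrightarrow> cube_mean A (\<lambda>X. (s + (\<Sum>i\<in>A. cube_sign X i * c i))\<^sup>2) = s\<^sup>2 + (\<Sum>i\<in>A. (c i)\<^sup>2)"
proof (induction A arbitrary: s rule: finite_induct)
  case empty
  then show ?case by (simp add: cube_mean_empty)
next
  case (insert a A)
  let ?S = "\<lambda>X. \<Sum>i\<in>A. cube_sign X i * c i"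
  have "cube_mean (insert a A) (\<lambda>X. (s + (\<Sum>i\<in>insert a A. cube_sign X i * c i))\<^sup>2)
      = cube_mean A (\<lambda>X. (1/2) * ((s - c a) + ?S X)\<^sup>2 + (1/2) * ((s + c a) + ?S X)\<^sup>2)"
    unfolding cube_mean_insert[OF insert.hyps]
  proof (rule cube_mean_cong)
    fix X assume "X \<subseteq> A"
    then have "cube_sign X a = -1" using insert.hyps by (auto simp: cube_sign_def)
    moreover have "cube_sign (insert a X) a = 1" by (simp add: cube_sign_def)
    moreover have "(\<Sum>i\<in>A. cube_sign (insert a X) i * c i) = ?S X"
      using insert.hyps by (intro sum.cong) (auto simp: cube_sign_def)
    ultimately show "((s + (\<Sum>i\<in>insert a A. cube_sign X i * c i))\<^sup>2
        + (s + (\<Sum>i\<in>insert a A. cube_sign (insert a X) i * c i))\<^sup>2) / 2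
      = (1/2) * ((s - c a) + ?S X)\<^sup>2 + (1/2) * ((s + c a) + ?S X)\<^sup>2"
      using insert.hyps by (simp add: algebra_simps)
  qed
  also have "\<dots> = (1/2) * ((s - c a)\<^sup>2 + (\<Sum>i\<in>A. (c i)\<^sup>2)) + (1/2) * ((s + c a)\<^sup>2 + (\<Sum>i\<in>A. (c i)\<^sup>2))"
    by (simp only: cube_mean_add cube_mean_cmult insert.IH)
  also have "\<dots> = s\<^sup>2 + (\<Sum>i\<in>insert a A. (c i)\<^sup>2)"
    using insert.hyps by (simp add: power2_eq_square algebra_simps)
  finally show ?case .
qed

lemma L2_set_sum_le:
  "L2_set (\<lambda>i. \<Sum>j\<in>B. f i j) A \<le> (\<Sum>j\<in>B. L2_set (\<lambda>i. f i j) A)"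
proof (induction B rule: infinite_finite_induct)
  case (insert j B)
  then show ?case
    using L2_set_triangle_ineq[of "\<lambda>i. f i j" "\<lambda>i. \<Sum>j\<in>B. f i j" A] by simp
qed (simp_all add: L2_set_def)

lemma L2_set_cmult: "L2_set (\<lambda>i. c * f i) A = \<bar>c\<bar> * L2_set f A"
  by (simp add: L2_set_def power_mult_distrib real_sqrt_mult flip: sum_distrib_left)

text \<open>The function to which the cube inequality is applied is the norm of the signed sum \<open>v\<close>. The
  sum of \<open>v\<close> over the neighbours of a point is \<open>card A - 2\<close> times its value at that point,
  since each summand changes sign exactly once; the triangle inequality does the rest.
  The constant \<open>sqrt 2\<close> is the best possible, as two equal vectors show.\<close>

lemma khinchine_kahane_L2:
  fixes b :: "'i \<Rightarrow> 'j \<Rightarrow> real"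
  assumes "finite A"
  shows "L2_set (\<lambda>i. L2_set (b i) J) A
       \<le> sqrt 2 * cube_mean A (\<lambda>X. L2_set (\<lambda>t. \<Sum>i\<in>A. cube_sign X i * b i t) J)"
proof -
  define v where "v = (\<lambda>X t. \<Sum>i\<in>A. cube_sign X i * b i t)"
  define f where "f = (\<lambda>X. L2_set (v X) J)"
  have f_nonneg: "0 \<le> f X" for X by (simp add: f_def)
  have "cube_mean A (\<lambda>X. (f X)\<^sup>2) \<le> 2 * (cube_mean A f)\<^sup>2"
  proof (rule mean_square_le_two_square_mean[OF \<open>finite A\<close> f_nonneg])
    fix X assume "X \<subseteq> A"
    have "v (A - X) t = (-1) * v X t" for t
      unfolding v_def sum_distrib_left
      using \<open>X \<subseteq> A\<close> by (intro sum.cong) (auto simp: cube_sign_def)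
    then have "v (A - X) = (\<lambda>t. (-1) * v X t)" by (rule ext)
    then show "f (A - X) = f X"
      unfolding f_def by (simp only: L2_set_cmult)
    have "v (flip i X) t = v X t - 2 * (cube_sign X i * b i t)" if "i \<in> A" for i t
    proof -
      have "v (flip i X) t = cube_sign (flip i X) i * b i t
          + (\<Sum>k\<in>A - {i}. cube_sign (flip i X) k * b k t)"
        unfolding v_def using that \<open>finite A\<close> by (intro sum.remove) auto
      also have "(\<Sum>k\<in>A - {i}. cube_sign (flip i X) k * b k t)
          = (\<Sum>k\<in>A - {i}. cube_sign X k * b k t)"
        by (intro sum.cong) (auto simp: cube_sign_def flip_def)
      also have "cube_sign (flip i X) i = - cube_sign X i"
        by (auto simp: cube_sign_def flip_def)
      also have "(\<Sum>k\<in>A - {i}. cube_sign X k * b k t) = v X t - cube_sign X i * b i t"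
        unfolding v_def using that \<open>finite A\<close> by (simp add: sum.remove)
      finally show ?thesis by simp
    qed
    then have "(\<Sum>i\<in>A. v (flip i X) t) = (\<Sum>i\<in>A. v X t) - 2 * v X t" for t
      by (simp add: sum_subtractf v_def flip: sum_distrib_left)
    then have sum_flips: "(\<Sum>i\<in>A. v (flip i X) t) = (real (card A) - 2) * v X t" for t
      by (simp add: algebra_simps)
    \<comment> \<open>For a single summand the factor \<open>card A - 2\<close> is negative; hence the absolute value.\<close>
    have "(real (card A) - 2) * f X \<le> \<bar>real (card A) - 2\<bar> * f X"
      using f_nonneg by (intro mult_right_mono) auto
    also have "\<dots> = L2_set (\<lambda>t. \<Sum>i\<in>A. v (flip i X) t) J"
      by (simp add: f_def sum_flips L2_set_cmult)
    also have "\<dots> \<le> (\<Sum>i\<in>A. f (flip i X))"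
      unfolding f_def by (rule L2_set_sum_le)
    finally show "(real (card A) - 2) * f X \<le> (\<Sum>i\<in>A. f (flip i X))" .
  qed
  also have "cube_mean A (\<lambda>X. (f X)\<^sup>2) = cube_mean A (\<lambda>X. \<Sum>t\<in>J. (v X t)\<^sup>2)"
    by (simp add: f_def L2_set_def sum_nonneg)
  also have "\<dots> = (\<Sum>t\<in>J. \<Sum>i\<in>A. (b i t)\<^sup>2)"
    using mean_square_signed_sum[OF \<open>finite A\<close>, of 0] by (simp add: cube_mean_sum v_def)
  also have "\<dots> = (L2_set (\<lambda>i. L2_set (b i) J) A)\<^sup>2"
    by (subst sum.swap) (simp add: L2_set_def sum_nonneg)
  finally have "(L2_set (\<lambda>i. L2_set (b i) J) A)\<^sup>2 \<le> (sqrt 2 * cube_mean A f)\<^sup>2"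
    by (simp add: power_mult_distrib)
  then have "L2_set (\<lambda>i. L2_set (b i) J) A \<le> sqrt 2 * cube_mean A f"
    by (rule power2_le_imp_le) (simp add: cube_mean_nonneg f_nonneg)
  then show ?thesis by (simp add: f_def v_def)
qed

text \<open>A point of the cube where the averaged quantity is maximal serves all indices \<open>t\<close>
  simultaneously.\<close>

lemma exists_signs_khinchine_kahane:
  fixes b :: "'t \<Rightarrow> 'i \<Rightarrow> 'j \<Rightarrow> real"
  assumes "finite A"
  shows "\<exists>X\<subseteq>A. (\<Sum>t\<in>B. L2_set (\<lambda>i. L2_set (b t i) J) A)
       \<le> sqrt 2 * (\<Sum>t\<in>B. L2_set (\<lambda>j. \<Sum>i\<in>A. cube_sign X i * b t i j) J)"
proof -
  define F where "F X = (\<Sum>t\<in>B. L2_set (\<lambda>j. \<Sum>i\<in>A. cube_sign X i * b t i j) J)" for X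
  have "finite (Pow A)" "Pow A \<noteq> {}" using assms by auto
  then have "Max (F ` Pow A) \<in> F ` Pow A" by (intro Max_in) auto
  then obtain X where X: "X \<in> Pow A" and "F X = Max (F ` Pow A)" by auto
  then have max: "F Y \<le> F X" if "Y \<in> Pow A" for Y
    using that \<open>finite (Pow A)\<close> by simp
  have "(\<Sum>t\<in>B. L2_set (\<lambda>i. L2_set (b t i) J) A) \<le> sqrt 2 * cube_mean A F"
    unfolding F_def cube_mean_sum sum_distrib_left
    by (intro sum_mono khinchine_kahane_L2 assms)
  also have "cube_mean A F \<le> cube_mean A (\<lambda>_. F X)"
    using max by (intro cube_mean_mono) auto
  also have "\<dots> = F X" using assms by (rule cube_mean_const)
  finally show ?thesis using X unfolding F_def by auto
qed

section \<open>Mixed norms\<close>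

definition indices :: "nat \<Rightarrow> nat \<Rightarrow> nat list set" where
  "indices N n = {js. set js \<subseteq> {..<N} \<and> length js = n}"

lemma indices_0: "indices N 0 = {[]}"
  by (auto simp: indices_def)

lemma finite_indices: "finite (indices N n)"
  by (simp add: indices_def finite_lists_length_eq)

lemma sum_indices_Suc: "(\<Sum>js\<in>indices N (Suc n). f js) = (\<Sum>j<N. \<Sum>js\<in>indices N n. f (j # js))"
proof -
  have "(\<Sum>j<N. \<Sum>js\<in>indices N n. f (j # js)) = (\<Sum>(j, js)\<in>{..<N} \<times> indices N n. f (j # js))"
    by (rule sum.cartesian_product)
  also have "\<dots> = (\<Sum>js\<in>indices N (Suc n). f js)"
    by (rule sum.reindex_bij_witness[where i = "\<lambda>js. (hd js, tl js)" and j = "\<lambda>(j, js). j # js"])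
      (auto simp: indices_def length_Suc_conv)
  finally show ?thesis by simp
qed

lemma L2_set_indices_Suc:
  "L2_set f (indices N (Suc n)) = L2_set (\<lambda>j. L2_set (\<lambda>js. f (j # js)) (indices N n)) {..<N}"
  by (simp add: L2_set_def sum_indices_Suc sum_nonneg)

lemma nested_sum_replicate_2:
  "nested_sum (replicate (Suc n) 2) N a = (\<Sum>js\<in>indices N (Suc n). (a js)\<^sup>2)"
proof (induction n arbitrary: a)
  case 0
  then show ?case by (simp add: sum_indices_Suc indices_0)
next
  case (Suc n)
  have "nested_sum (replicate (Suc (Suc n)) 2) N a
      = (\<Sum>j<N. nested_sum (replicate (Suc n) 2) N (\<lambda>js. a (j # js)) powr 1)"
    by simp
  also have "\<dots> = (\<Sum>j<N. \<Sum>js\<in>indices N (Suc n). (a (j # js))\<^sup>2)"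
    by (simp only: Suc.IH) (simp add: sum_nonneg)
  finally show ?case by (simp only: sum_indices_Suc[of _ _ "Suc n"])
qed

lemma nested_sum_1_replicate_2:
  "nested_sum (1 # replicate n 2) N a = (\<Sum>j<N. L2_set (\<lambda>js. a (j # js)) (indices N n))"
proof (cases n)
  case 0
  then show ?thesis by (simp add: indices_0 L2_set_def)
next
  case (Suc k)
  have "nested_sum (1 # replicate n 2) N a
      = (\<Sum>j<N. nested_sum (replicate (Suc k) 2) N (\<lambda>js. a (j # js)) powr (1 / 2))"
    by (simp add: Suc)
  then show ?thesis
    by (simp only: nested_sum_replicate_2 Suc) (simp add: L2_set_def powr_half_sqrt sum_nonneg)
qed

text \<open>All exponents after the second one are 2, so their nested sums collapse to a single
  Euclidean norm over multi-indices.\<close>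

lemma mixed_norm_2_1_2:
  "mixed_norm (2 # 1 # replicate n 2) N a
     = L2_set (\<lambda>i. \<Sum>j<N. L2_set (\<lambda>js. a (i # j # js)) (indices N n)) {..<N}"
proof -
  have "nested_sum (2 # 1 # replicate n 2) N a
      = (\<Sum>i<N. (\<Sum>j<N. L2_set (\<lambda>js. a (i # j # js)) (indices N n)) powr 2)"
    by (simp add: nested_sum_1_replicate_2)
  also have "\<dots> = (\<Sum>i<N. (\<Sum>j<N. L2_set (\<lambda>js. a (i # j # js)) (indices N n))\<^sup>2)"
    by (simp add: sum_nonneg)
  finally show ?thesis
    by (simp add: mixed_norm_def L2_set_def powr_half_sqrt sum_nonneg)
qed

section \<open>Multilinear forms\<close>

lemma multilinear_form_linear:
  assumes "multilinear_form m T" "z \<in> {..<m} \<rightarrow>\<^sub>E UNIV" "k < m"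
  shows "linear (\<lambda>x. T (z(k := x)))"
  using assms by (auto simp: multilinear_form_def)

lemma multilinear_form_sum:
  assumes "multilinear_form m T" "z \<in> {..<m} \<rightarrow>\<^sub>E UNIV" "k < m"
  shows "T (z(k := (\<Sum>i\<in>A. c i *\<^sub>R x i))) = (\<Sum>i\<in>A. c i * T (z(k := x i)))"
proof -
  interpret linear "\<lambda>x. T (z(k := x))"
    using assms by (rule multilinear_form_linear)
  show ?thesis by (simp add: sum scale)
qed

lemma multilinear_form_scale_all:
  assumes T: "multilinear_form m T" and z: "z \<in> {..<m} \<rightarrow>\<^sub>E UNIV"
  shows "T (\<lambda>k\<in>{..<m}. c *\<^sub>R z k) = c ^ m * T z"
proof -
  have "T (\<lambda>k\<in>{..<m}. if k < n then c *\<^sub>R z k else z k) = c ^ n * T z" if "n \<le> m" for n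
    using that
  proof (induction n)
    case 0
    have "(\<lambda>k\<in>{..<m}. z k) = z" using z by (auto simp: fun_eq_iff PiE_def extensional_def)
    then show ?case by simp
  next
    case (Suc n)
    define w where "w = (\<lambda>k\<in>{..<m}. if k < n then c *\<^sub>R z k else z k)"
    have w: "w \<in> {..<m} \<rightarrow>\<^sub>E UNIV" by (auto simp: w_def)
    interpret linear "\<lambda>x. T (w(n := x))"
      by (rule multilinear_form_linear[OF T w]) (use Suc.prems in simp)
    have "(\<lambda>k\<in>{..<m}. if k < Suc n then c *\<^sub>R z k else z k) = w(n := c *\<^sub>R z n)"
      using Suc.prems by (auto simp: w_def fun_eq_iff less_Suc_eq)
    then have "T (\<lambda>k\<in>{..<m}. if k < Suc n then c *\<^sub>R z k else z k) = c * T (w(n := z n))"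
      using scale[of c "z n"] by (simp only: real_scaleR_def)
    also have "w(n := z n) = w"
      using Suc.prems by (auto simp: w_def fun_eq_iff)
    also have "T w = c ^ n * T z"
      unfolding w_def by (rule Suc.IH) (use Suc.prems in simp)
    finally show ?case by simp
  qed
  from this[of m] show ?thesis
    by (simp cong: restrict_cong)
qed

text \<open>Without this bound the supremum in \<open>form_norm\<close> would not be an upper bound. Continuity at the
  origin bounds the form by one on a small product of balls; homogeneity of degree \<open>m\<close> carries
  the bound to the unit balls.\<close>

lemma continuous_multilinear_form_bdd_above:
  fixes T :: "(nat \<Rightarrow> 'a::real_normed_vector) \<Rightarrow> real"
  assumes T: "continuous_multilinear_form m T" and "0 < m"
  shows "bdd_above ((\<lambda>z. \<bar>T z\<bar>) ` ({..<m} \<rightarrow>\<^sub>E cball 0 1))"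
proof -
  have lin: "multilinear_form m T"
    and cont: "continuous_map (product_topology (\<lambda>_. euclidean) {..<m}) euclidean T"
    using T by (auto simp: continuous_multilinear_form_def)
  define p where "p = (\<lambda>k\<in>{..<m}. 0 :: 'a)"
  have p: "p \<in> {..<m} \<rightarrow>\<^sub>E UNIV" by (auto simp: p_def)
  have "T p = 0"
  proof -
    have "(\<lambda>k\<in>{..<m}. 0 *\<^sub>R p k) = p" by (simp add: p_def)
    then show ?thesis
      using multilinear_form_scale_all[OF lin p, of 0] \<open>0 < m\<close> by (simp only: power_0_left) simp
  qed
  have "openin (product_topology (\<lambda>_. euclidean) {..<m})
      {z \<in> topspace (product_topology (\<lambda>_. euclidean) {..<m}). T z \<in> {-1<..<1}}"
    by (rule openin_continuous_map_preimage[OF cont]) auto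
  then obtain U where U: "\<forall>k\<in>{..<m}. open (U k)" "p \<in> Pi\<^sub>E {..<m} U"
    "Pi\<^sub>E {..<m} U \<subseteq> {z \<in> topspace (product_topology (\<lambda>_. euclidean) {..<m}). T z \<in> {-1<..<1}}"
    unfolding openin_product_topology_alt using \<open>T p = 0\<close> p by (auto simp: topspace_product_topology)
  have "open (\<Inter>k<m. U k)" "0 \<in> (\<Inter>k<m. U k)"
    using U by (auto simp: p_def PiE_def Pi_def)
  then obtain e where "e > 0" and e: "cball 0 e \<subseteq> (\<Inter>k<m. U k)"
    using open_contains_cball by metis
  have "\<bar>T z\<bar> \<le> 1 / e ^ m" if z: "z \<in> {..<m} \<rightarrow>\<^sub>E cball 0 1" for z
  proof -
    have "e *\<^sub>R z k \<in> U k" if "k < m" for k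
    proof -
      have "norm (e *\<^sub>R z k) \<le> e * 1"
        unfolding norm_scaleR using z that \<open>e > 0\<close> by (intro mult_mono) (auto simp: PiE_def Pi_def)
      then have "e *\<^sub>R z k \<in> cball 0 e" by simp
      then show ?thesis using e that by blast
    qed
    then have "(\<lambda>k\<in>{..<m}. e *\<^sub>R z k) \<in> Pi\<^sub>E {..<m} U" by auto
    then have "T (\<lambda>k\<in>{..<m}. e *\<^sub>R z k) \<in> {-1<..<1}" using U(3) by blast
    then have "\<bar>T (\<lambda>k\<in>{..<m}. e *\<^sub>R z k)\<bar> < 1"
      unfolding greaterThanLessThan_iff by linarith
    moreover have "T (\<lambda>k\<in>{..<m}. e *\<^sub>R z k) = e ^ m * T z"
      using z by (intro multilinear_form_scale_all[OF lin]) auto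
    ultimately show ?thesis
      using \<open>e > 0\<close> by (simp add: abs_mult field_simps)
  qed
  then show ?thesis by (rule bdd_aboveI2)
qed

lemma abs_le_form_norm:
  fixes T :: "(nat \<Rightarrow> 'a::real_normed_vector) \<Rightarrow> real"
  assumes "continuous_multilinear_form m T" "0 < m" "z \<in> {..<m} \<rightarrow>\<^sub>E cball 0 1"
  shows "\<bar>T z\<bar> \<le> form_norm m T"
  unfolding form_norm_def
  by (rule cSUP_upper[OF assms(3) continuous_multilinear_form_bdd_above[OF assms(1,2)]])

lemma c0_nth_unit: "c0_nth (c0_unit j) i = (if i = j then 1 else 0)"
  by (simp add: c0_unit.rep_eq)

lemma c0_nth_sum: "c0_nth (\<Sum>i\<in>A. f i) j = (\<Sum>i\<in>A. c0_nth (f i) j)"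
  by (induction A rule: infinite_finite_induct) auto

lemma norm_sum_c0_unit_le:
  assumes "\<And>i. i < N \<Longrightarrow> \<bar>c i\<bar> \<le> 1"
  shows "norm (\<Sum>i<N. c i *\<^sub>R c0_unit i) \<le> 1"
proof (rule c0_norm_le)
  fix j
  have "c0_nth (\<Sum>i<N. c i *\<^sub>R c0_unit i) j = (\<Sum>i<N. if i = j then c i else 0)"
    unfolding c0_nth_sum by (intro sum.cong) (auto simp: c0_nth_unit)
  also have "\<dots> = (if j < N then c j else 0)" by simp
  finally show "\<bar>c0_nth (\<Sum>i<N. c i *\<^sub>R c0_unit i) j\<bar> \<le> 1" using assms by auto
qed

section \<open>The upper bound\<close>

text \<open>The values of a form at \<open>place_units z ks js\<close> are its coefficients in the coordinates \<open>ks\<close>, the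
  others being frozen at \<open>z\<close>. The recursion follows \<open>ks\<close>, so that the coordinates can be treated
  one after the other.\<close>

fun place_units :: "(nat \<Rightarrow> c0) \<Rightarrow> nat list \<Rightarrow> nat list \<Rightarrow> nat \<Rightarrow> c0" where
  "place_units z (k # ks) (j # js) = place_units (z(k := c0_unit j)) ks js"
| "place_units z _ _ = z"

lemma place_units_fun_upd:
  "k \<notin> set ks \<Longrightarrow> place_units (z(k := x)) ks js = (place_units z ks js)(k := x)"
proof (induction z ks js rule: place_units.induct)
  case (1 z i ls j js)
  then have "(z(k := x))(i := c0_unit j) = (z(i := c0_unit j))(k := x)"
    by (intro fun_upd_twist) auto
  then have "place_units (z(k := x)) (i # ls) (j # js)
      = place_units ((z(i := c0_unit j))(k := x)) ls js"
    by (simp only: place_units.simps)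
  also have "\<dots> = (place_units (z(i := c0_unit j)) ls js)(k := x)"
    using 1 by (intro "1.IH") auto
  finally show ?case by (simp only: place_units.simps)
qed auto

lemma place_units_PiE:
  "z \<in> {..<m} \<rightarrow>\<^sub>E UNIV \<Longrightarrow> set ks \<subseteq> {..<m} \<Longrightarrow> place_units z ks js \<in> {..<m} \<rightarrow>\<^sub>E UNIV"
  by (induction z ks js rule: place_units.induct) (auto simp: PiE_def extensional_def)

lemma place_units_upt:
  "place_units z [i..<i + length js] js k
     = (if i \<le> k \<and> k < i + length js then c0_unit (js ! (k - i)) else z k)"
proof (induction js arbitrary: i z)
  case Nil
  then show ?case by auto
next
  case (Cons j js)
  have "[i..<i + length (j # js)] = i # [Suc i..<Suc i + length js]"
    by (simp add: upt_rec[of i] Suc_le_eq)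
  then have "place_units z [i..<i + length (j # js)] (j # js) k
      = place_units (z(i := c0_unit j)) [Suc i..<Suc i + length js] js k"
    by (simp only: place_units.simps)
  also have "\<dots> = (if Suc i \<le> k \<and> k < Suc i + length js then c0_unit (js ! (k - Suc i))
      else (z(i := c0_unit j)) k)"
    by (rule Cons.IH)
  also have "\<dots> = (if i \<le> k \<and> k < i + length (j # js) then c0_unit ((j # js) ! (k - i)) else z k)"
    by (auto simp: nth_Cons')
  finally show ?case .
qed

text \<open>Each coordinate in \<open>ks\<close> costs one application of the Khinchine-Kahane inequality, with values in
  the Euclidean space of the remaining coefficients. The chosen signs give a vector of norm at
  most one, and by linearity the signed sum of the coefficients is the value of the form at
  that vector. It is essential that the point \<open>y\<close> is the same for all \<open>t\<close>, so that the sum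
  over \<open>t\<close> can afterwards be absorbed by the remaining coordinate.\<close>

lemma exists_point_for_L2_sums:
  fixes T :: "(nat \<Rightarrow> c0) \<Rightarrow> real" and z :: "'t \<Rightarrow> nat \<Rightarrow> c0"
  assumes T: "multilinear_form m T"
    and "distinct ks" "set ks \<subseteq> {..<m}" "\<And>t. z t \<in> {..<m} \<rightarrow>\<^sub>E UNIV"
  shows "\<exists>y. (\<forall>k. norm (y k) \<le> 1) \<and>
      (\<Sum>t\<in>B. L2_set (\<lambda>js. T (place_units (z t) ks js)) (indices N (length ks)))
        \<le> sqrt 2 ^ length ks * (\<Sum>t\<in>B. \<bar>T (override_on (z t) y (set ks))\<bar>)"
  using assms(2-)
proof (induction ks arbitrary: z)
  case Nil
  have "norm (0 :: c0) \<le> 1" by simp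
  then show ?case
    by (intro exI[of _ "\<lambda>_. 0"]) (simp add: indices_0)
next
  case (Cons k ks)
  define n where "n = length ks"
  define b where "b = (\<lambda>t j js. T (place_units ((z t)(k := c0_unit j)) ks js))"
  obtain X where X: "(\<Sum>t\<in>B. L2_set (\<lambda>j. L2_set (b t j) (indices N n)) {..<N})
      \<le> sqrt 2 * (\<Sum>t\<in>B. L2_set (\<lambda>js. \<Sum>j<N. cube_sign X j * b t j js) (indices N n))"
    using exists_signs_khinchine_kahane[where A = "{..<N}" and B = B and b = b and J = "indices N n"] by auto
  define x where "x = (\<Sum>j<N. cube_sign X j *\<^sub>R c0_unit j)"
  have x: "norm x \<le> 1"
    unfolding x_def by (rule norm_sum_c0_unit_le) (simp add: cube_sign_def)
  have "(\<Sum>j<N. cube_sign X j * b t j js) = T (place_units ((z t)(k := x)) ks js)" for t js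
    unfolding b_def x_def using Cons.prems
    by (simp add: place_units_fun_upd multilinear_form_sum[OF T place_units_PiE])
  with X have step: "(\<Sum>t\<in>B. L2_set (\<lambda>j. L2_set (b t j) (indices N n)) {..<N})
      \<le> sqrt 2 * (\<Sum>t\<in>B. L2_set (\<lambda>js. T (place_units ((z t)(k := x)) ks js)) (indices N n))"
    by simp
  obtain y where y: "\<forall>i. norm (y i) \<le> 1"
    and IH: "(\<Sum>t\<in>B. L2_set (\<lambda>js. T (place_units ((z t)(k := x)) ks js)) (indices N n))
        \<le> sqrt 2 ^ n * (\<Sum>t\<in>B. \<bar>T (override_on ((z t)(k := x)) y (set ks))\<bar>)"
  proof -
    have "(z t)(k := x) \<in> {..<m} \<rightarrow>\<^sub>E UNIV" for t
      using Cons.prems by (auto simp: PiE_def extensional_def)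
    then show ?thesis
      using Cons.IH[of "\<lambda>t. (z t)(k := x)"] Cons.prems(1,2) that unfolding n_def
      by (meson distinct.simps(2) list.set_intros(2) subset_iff)
  qed
  have override: "override_on (z t) (y(k := x)) (set (k # ks)) = override_on ((z t)(k := x)) y (set ks)" for t
    using Cons.prems by (auto simp: override_on_def fun_eq_iff)
  have "(\<Sum>t\<in>B. L2_set (\<lambda>js. T (place_units (z t) (k # ks) js)) (indices N (length (k # ks))))
      = (\<Sum>t\<in>B. L2_set (\<lambda>j. L2_set (b t j) (indices N n)) {..<N})"
    by (simp add: L2_set_indices_Suc b_def n_def)
  also note step
  also have "sqrt 2 * (\<Sum>t\<in>B. L2_set (\<lambda>js. T (place_units ((z t)(k := x)) ks js)) (indices N n))
      \<le> sqrt 2 * (sqrt 2 ^ n * (\<Sum>t\<in>B. \<bar>T (override_on ((z t)(k := x)) y (set ks))\<bar>))"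
    using IH by (intro mult_left_mono) auto
  finally have "(\<Sum>t\<in>B. L2_set (\<lambda>js. T (place_units (z t) (k # ks) js)) (indices N (length (k # ks))))
      \<le> sqrt 2 ^ length (k # ks) * (\<Sum>t\<in>B. \<bar>T (override_on (z t) (y(k := x)) (set (k # ks)))\<bar>)"
    unfolding override by (simp add: n_def mult.assoc)
  moreover have "\<forall>i. norm ((y(k := x)) i) \<le> 1" using x y by simp
  ultimately show ?case by blast
qed

text \<open>The vector of the signs of the values is admissible in the coordinate \<open>k\<close>.\<close>

lemma sum_abs_le_form_norm:
  fixes T :: "(nat \<Rightarrow> c0) \<Rightarrow> real"
  assumes T: "continuous_multilinear_form m T" and "k < m"
    and z: "z \<in> {..<m} \<rightarrow>\<^sub>E cball 0 1"
  shows "(\<Sum>j<N. \<bar>T (z(k := c0_unit j))\<bar>) \<le> form_norm m T"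
proof -
  define s where "s j = sgn (T (z(k := c0_unit j)))" for j
  define x where "x = (\<Sum>j<N. s j *\<^sub>R c0_unit j)"
  have "norm x \<le> 1"
    unfolding x_def by (rule norm_sum_c0_unit_le) (simp add: s_def sgn_if)
  then have "z(k := x) \<in> {..<m} \<rightarrow>\<^sub>E cball 0 1"
    using z \<open>k < m\<close> by (auto simp: PiE_def extensional_def Pi_def)
  from abs_le_form_norm[OF T _ this] have "\<bar>T (z(k := x))\<bar> \<le> form_norm m T"
    using \<open>k < m\<close> by linarith
  moreover have "T (z(k := x)) = (\<Sum>j<N. \<bar>T (z(k := c0_unit j))\<bar>)"
  proof -
    have "multilinear_form m T" using T by (simp add: continuous_multilinear_form_def)
    moreover have "z \<in> {..<m} \<rightarrow>\<^sub>E UNIV" using z by auto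
    ultimately have "T (z(k := x)) = (\<Sum>j<N. s j * T (z(k := c0_unit j)))"
      unfolding x_def using \<open>k < m\<close> by (rule multilinear_form_sum)
    then show ?thesis by (simp add: s_def abs_sgn mult.commute)
  qed
  ultimately show ?thesis by simp
qed

lemma sqrt_2_power_eq_powr:
  assumes "m \<ge> 1"
  shows "sqrt 2 ^ (m - 1) = 2 powr ((real m - 1) / 2)"
proof -
  have "sqrt 2 ^ (m - 1) = (2 powr (1/2)) powr real (m - 1)"
    by (simp add: powr_half_sqrt powr_realpow)
  also have "\<dots> = 2 powr ((real m - 1) / 2)"
    using assms by (simp add: powr_powr of_nat_diff)
  finally show ?thesis .
qed

text \<open>Minkowski's inequality moves the sum over the second index outside. What remains under it is a
  Euclidean norm over the other \<open>m - 1\<close> indices, each of which costs a factor \<open>sqrt 2\<close>.\<close>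

lemma littlewood_constant_2_1_2:
  assumes "m \<ge> 2"
  shows "littlewood_constant m (2 # 1 # replicate (m - 2) 2) (2 powr ((real m - 1) / 2))"
  unfolding littlewood_constant_def
proof (intro allI impI)
  fix T :: "(nat \<Rightarrow> c0) \<Rightarrow> real" and N :: nat
  assume T: "continuous_multilinear_form m T" and "0 < N"
  then have lin: "multilinear_form m T" by (simp add: continuous_multilinear_form_def)
  define n where "n = m - 2"
  define a where "a js = T (\<lambda>k\<in>{..<m}. c0_unit (js ! k))" for js
  \<comment> \<open>Coordinate 1, the second index, is the one left out of \<open>ks\<close>; the zeros are overwritten.\<close>
  define z where "z j = (\<lambda>k\<in>{..<m}. if k = 1 then c0_unit j else 0)" for j
  define ks where "ks = 0 # [2..<m]"
  have ks: "distinct ks" "set ks = {..<m} - {1}" "length ks = Suc n"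
    using assms by (auto simp: ks_def n_def)
  have z: "z j \<in> {..<m} \<rightarrow>\<^sub>E UNIV" for j by (auto simp: z_def)
  have place: "a (i # j # js) = T (place_units (z j) ks (i # js))" if "js \<in> indices N n" for i j js
  proof -
    have len: "2 + length js = m" using that assms by (simp add: indices_def n_def)
    have "place_units (z j) ks (i # js) k = (\<lambda>k\<in>{..<m}. c0_unit ((i # j # js) ! k)) k" for k
    proof -
      have "place_units (z j) ks (i # js) k
          = place_units ((z j)(0 := c0_unit i)) [2..<2 + length js] js k"
        unfolding ks_def len by (simp only: place_units.simps)
      also have "\<dots> = (if 2 \<le> k \<and> k < m then c0_unit (js ! (k - 2)) else ((z j)(0 := c0_unit i)) k)"
        using place_units_upt[of _ 2 js k] by (simp only: len)
      also have "\<dots> = (\<lambda>k\<in>{..<m}. c0_unit ((i # j # js) ! k)) k"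
      proof -
        consider "k = 0" | "k = 1" | l where "k = Suc (Suc l)"
          by (metis One_nat_def not0_implies_Suc)
        then show ?thesis using assms by cases (auto simp: z_def)
      qed
      finally show ?thesis .
    qed
    then show ?thesis unfolding a_def by (metis ext)
  qed
  obtain y where y: "\<forall>k. norm (y k) \<le> 1"
    and le: "(\<Sum>j<N. L2_set (\<lambda>js. T (place_units (z j) ks js)) (indices N (Suc n)))
        \<le> sqrt 2 ^ Suc n * (\<Sum>j<N. \<bar>T (override_on (z j) y ({..<m} - {1}))\<bar>)"
    using exists_point_for_L2_sums[where ks = ks and z = z and B = "{..<N}" and N = N, OF lin ks(1) _ z]
    unfolding ks(2,3) by blast
  have "mixed_norm (2 # 1 # replicate n 2) N a
      = L2_set (\<lambda>i. \<Sum>j<N. L2_set (\<lambda>js. a (i # j # js)) (indices N n)) {..<N}"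
    by (rule mixed_norm_2_1_2)
  also have "\<dots> \<le> (\<Sum>j<N. L2_set (\<lambda>i. L2_set (\<lambda>js. a (i # j # js)) (indices N n)) {..<N})"
    by (rule L2_set_sum_le)
  also have "\<dots> = (\<Sum>j<N. L2_set (\<lambda>js. T (place_units (z j) ks js)) (indices N (Suc n)))"
    unfolding L2_set_indices_Suc by (intro sum.cong refl L2_set_cong place)
  also note le
  also have "(\<Sum>j<N. \<bar>T (override_on (z j) y ({..<m} - {1}))\<bar>)
      = (\<Sum>j<N. \<bar>T ((\<lambda>k\<in>{..<m}. y k)(1 := c0_unit j))\<bar>)"
  proof (rule sum.cong)
    fix j
    have "override_on (z j) y ({..<m} - {1}) = (\<lambda>k\<in>{..<m}. y k)(1 := c0_unit j)"
      using assms by (auto simp: fun_eq_iff override_on_def z_def)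
    then show "\<bar>T (override_on (z j) y ({..<m} - {1}))\<bar> = \<bar>T ((\<lambda>k\<in>{..<m}. y k)(1 := c0_unit j))\<bar>"
      by simp
  qed simp
  also have "sqrt 2 ^ Suc n * \<dots> \<le> sqrt 2 ^ Suc n * form_norm m T"
    using y assms by (intro mult_left_mono sum_abs_le_form_norm[OF T]) auto
  also have "sqrt 2 ^ Suc n = 2 powr ((real m - 1) / 2)"
    using sqrt_2_power_eq_powr[of m] assms by (simp add: n_def Suc_diff_Suc numeral_2_eq_2)
  finally show "mixed_norm (2 # 1 # replicate (m - 2) 2) N (\<lambda>js. T (\<lambda>k\<in>{..<m}. c0_unit (js ! k)))
      \<le> 2 powr ((real m - 1) / 2) * form_norm m T"
    by (simp only: a_def n_def)
qed

section \<open>The extremal form\<close>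

text \<open>This is the expansion of the product on the right over the choices, for every \<open>k\<close>, of one of its
  two summands.\<close>

lemma sum_prod_signs:
  fixes f g :: "'a \<Rightarrow> real"
  assumes "finite K"
  shows "(\<Sum>X\<in>Pow K. \<Prod>k\<in>K. \<bar>f k + cube_sign X k * g k\<bar>) = (\<Prod>k\<in>K. \<bar>f k + g k\<bar> + \<bar>f k - g k\<bar>)"
proof -
  have "(\<Prod>k\<in>K. \<bar>f k + cube_sign X k * g k\<bar>)
      = (\<Prod>k\<in>X. \<bar>f k + g k\<bar>) * (\<Prod>k\<in>K - X. \<bar>f k - g k\<bar>)" if "X \<in> Pow K" for X
  proof -
    have "(\<Prod>k\<in>K. \<bar>f k + cube_sign X k * g k\<bar>)
        = (\<Prod>k\<in>K - X. \<bar>f k + cube_sign X k * g k\<bar>) * (\<Prod>k\<in>X. \<bar>f k + cube_sign X k * g k\<bar>)"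
      using that assms by (intro prod.subset_diff) auto
    also have "(\<Prod>k\<in>K - X. \<bar>f k + cube_sign X k * g k\<bar>) = (\<Prod>k\<in>K - X. \<bar>f k - g k\<bar>)"
      by (intro prod.cong) (auto simp: cube_sign_def)
    also have "(\<Prod>k\<in>X. \<bar>f k + cube_sign X k * g k\<bar>) = (\<Prod>k\<in>X. \<bar>f k + g k\<bar>)"
      by (intro prod.cong) (auto simp: cube_sign_def)
    finally show ?thesis by (simp add: mult.commute)
  qed
  then show ?thesis
    using assms by (simp add: prod_add)
qed

text \<open>The extremal form. The function \<open>h\<close> is meant to enumerate the sign patterns on the coordinates
  other than 1, that is, the subsets of \<open>{..<m} - {1}\<close>. If the two relevant entries in each
  of these coordinates are signs, then exactly one of the products is nonzero, and it is
  \<open>2 ^ (m - 1)\<close> in absolute value. Thus equality holds in each use of the Khinchine-Kahane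
  inequality above.\<close>

definition sign_form :: "nat \<Rightarrow> (nat \<Rightarrow> nat set) \<Rightarrow> (nat \<Rightarrow> c0) \<Rightarrow> real" where
  "sign_form m h z = (\<Sum>j<2 ^ (m - 1). c0_nth (z 1) j *
     (\<Prod>k\<in>{..<m} - {1}. c0_nth (z k) 0 + cube_sign (h j) k * c0_nth (z k) 1))"

lemma multilinear_sign_form:
  "multilinear_form m (sign_form m h)"
  unfolding multilinear_form_def
proof (intro ballI allI impI)
  fix z :: "nat \<Rightarrow> c0" and k assume "k < m"
  define K where "K = {..<m} - {1}"
  define L where "L j i x = c0_nth x 0 + cube_sign (h j) i * c0_nth x 1" for j i x
  have form: "sign_form m h w = (\<Sum>j<2 ^ (m - 1). c0_nth (w 1) j * (\<Prod>i\<in>K. L j i (w i)))" for w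
    by (simp add: sign_form_def K_def L_def)
  show "linear (\<lambda>x. sign_form m h (z(k := x)))"
  proof (cases "k = 1")
    case True
    have "(\<Prod>i\<in>K. L j i ((z(k := x)) i)) = (\<Prod>i\<in>K. L j i (z i))" for j x
      using True by (intro prod.cong) (auto simp: K_def)
    then have "sign_form m h (z(k := x))
        = (\<Sum>j<2 ^ (m - 1). c0_nth x j * (\<Prod>i\<in>K. L j i (z i)))" for x
      using True by (simp add: form)
    then show ?thesis
      by (intro linearI) (simp_all add: sum.distrib sum_distrib_left distrib_right mult.assoc)
  next
    case False
    then have "k \<in> K" "finite K" using \<open>k < m\<close> by (auto simp: K_def)
    have "(\<Prod>i\<in>K. L j i ((z(k := x)) i)) = L j k x * (\<Prod>i\<in>K - {k}. L j i (z i))" for j x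
    proof -
      have "(\<Prod>i\<in>K. L j i ((z(k := x)) i))
          = L j k ((z(k := x)) k) * (\<Prod>i\<in>K - {k}. L j i ((z(k := x)) i))"
        using \<open>finite K\<close> \<open>k \<in> K\<close> by (rule prod.remove)
      also have "(\<Prod>i\<in>K - {k}. L j i ((z(k := x)) i)) = (\<Prod>i\<in>K - {k}. L j i (z i))"
        by (intro prod.cong) auto
      finally show ?thesis by simp
    qed
    then have "sign_form m h (z(k := x))
        = (\<Sum>j<2 ^ (m - 1). c0_nth (z 1) j * (L j k x * (\<Prod>i\<in>K - {k}. L j i (z i))))" for x
      using False by (simp add: form)
    then show ?thesis
      by (intro linearI)
        (simp_all add: L_def sum.distrib[symmetric] sum_distrib_left algebra_simps)
  qed
qed

lemma continuous_map_c0_nth: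
  "k \<in> I \<Longrightarrow> continuous_map (product_topology (\<lambda>_. euclidean) I) euclidean (\<lambda>z. c0_nth (z k) j)"
proof -
  assume "k \<in> I"
  have "bounded_linear (\<lambda>x. c0_nth x j)"
    by (rule bounded_linear_intro[where K = 1]) (use c0_nth_le_norm in auto)
  then have "continuous_map euclidean euclidean (\<lambda>x. c0_nth x j)"
    by (simp add: linear_continuous_on)
  from continuous_map_compose[OF continuous_map_product_projection[OF \<open>k \<in> I\<close>] this]
  show ?thesis by (simp add: comp_def)
qed

lemma continuous_multilinear_sign_form:
  assumes "m \<ge> 2"
  shows "continuous_multilinear_form m (sign_form m h)"
  unfolding continuous_multilinear_form_def
proof
  show "continuous_map (product_topology (\<lambda>_. euclidean) {..<m}) euclidean (sign_form m h)"
    unfolding sign_form_def using assms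
    by (intro continuous_map_sum continuous_map_prod continuous_map_real_mult continuous_map_add
        continuous_map_c0_nth) auto
qed (rule multilinear_sign_form)

lemma form_norm_sign_form_le:
  assumes "m \<ge> 2" and h: "bij_betw h {..<2 ^ (m - 1)} (Pow ({..<m} - {1}))"
  shows "form_norm m (sign_form m h) \<le> 2 ^ (m - 1)"
  unfolding form_norm_def
proof (rule cSUP_least)
  have "(\<lambda>k\<in>{..<m}. 0) \<in> {..<m} \<rightarrow>\<^sub>E cball (0 :: c0) 1" by auto
  then show "{..<m} \<rightarrow>\<^sub>E cball (0 :: c0) 1 \<noteq> {}" by blast
next
  fix z :: "nat \<Rightarrow> c0" assume z: "z \<in> {..<m} \<rightarrow>\<^sub>E cball 0 1"
  define K where "K = {..<m} - {1}"
  have "finite K" "card K = m - 1" using assms by (auto simp: K_def)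
  have nth: "\<bar>c0_nth (z k) j\<bar> \<le> 1" if "k < m" for k j
    using c0_nth_le_norm[of "z k" j] z that by (fastforce simp: PiE_def Pi_def)
  let ?f = "\<lambda>k. c0_nth (z k) 0" and ?g = "\<lambda>k. c0_nth (z k) 1"
  have "\<bar>sign_form m h z\<bar> \<le> (\<Sum>j<2 ^ (m - 1). \<bar>c0_nth (z 1) j\<bar> * (\<Prod>k\<in>K. \<bar>?f k + cube_sign (h j) k * ?g k\<bar>))"
    unfolding sign_form_def K_def[symmetric]
    by (rule order_trans[OF sum_abs]) (simp add: abs_mult abs_prod)
  also have "\<dots> \<le> (\<Sum>j<2 ^ (m - 1). \<Prod>k\<in>K. \<bar>?f k + cube_sign (h j) k * ?g k\<bar>)"
    using nth[of 1] assms by (intro sum_mono mult_left_le_one_le prod_nonneg) auto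
  also have "\<dots> = (\<Sum>X\<in>Pow K. \<Prod>k\<in>K. \<bar>?f k + cube_sign X k * ?g k\<bar>)"
    using sum.reindex_bij_betw[OF h, of "\<lambda>X. \<Prod>k\<in>K. \<bar>?f k + cube_sign X k * ?g k\<bar>"]
    by (simp add: K_def)
  also have "\<dots> = (\<Prod>k\<in>K. \<bar>?f k + ?g k\<bar> + \<bar>?f k - ?g k\<bar>)"
    using \<open>finite K\<close> by (rule sum_prod_signs)
  also have "\<dots> \<le> (\<Prod>k\<in>K. 2)"
  proof (rule prod_mono)
    fix k assume "k \<in> K"
    then have "\<bar>?f k\<bar> \<le> 1" "\<bar>?g k\<bar> \<le> 1" using nth by (auto simp: K_def)
    then show "0 \<le> \<bar>?f k + ?g k\<bar> + \<bar>?f k - ?g k\<bar> \<and> \<bar>?f k + ?g k\<bar> + \<bar>?f k - ?g k\<bar> \<le> 2"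
      by linarith
  qed
  finally show "\<bar>sign_form m h z\<bar> \<le> 2 ^ (m - 1)"
    using \<open>card K = m - 1\<close> by simp
qed

lemma abs_sign_form_units:
  assumes "m \<ge> 2" "j < 2 ^ (m - 1)"
  shows "\<bar>sign_form m h ((\<lambda>k\<in>{..<m}. c0_unit (i k))(1 := c0_unit j))\<bar>
       = (if \<forall>k\<in>{..<m} - {1}. i k < 2 then 1 else 0)"
proof -
  define K where "K = {..<m} - {1}"
  define z where "z = (\<lambda>k\<in>{..<m}. c0_unit (i k))(1 := c0_unit j)"
  \<comment> \<open>The unit vector in coordinate 1 selects a single product.\<close>
  have "\<bar>sign_form m h z\<bar>
      = \<bar>\<Sum>l<2 ^ (m - 1). (if l = j then 1 else 0) *
          (\<Prod>k\<in>K. c0_nth (z k) 0 + cube_sign (h l) k * c0_nth (z k) 1)\<bar>"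
    by (simp add: sign_form_def K_def z_def c0_nth_unit)
  also have "\<dots> = (\<Prod>k\<in>K. \<bar>c0_nth (z k) 0 + cube_sign (h j) k * c0_nth (z k) 1\<bar>)"
    using assms by (simp add: if_distrib[where f = "\<lambda>x. x * _"] abs_prod cong: if_cong)
  also have "\<dots> = (\<Prod>k\<in>K. if i k < 2 then 1 else 0)"
    by (intro prod.cong) (auto simp: K_def z_def c0_nth_unit cube_sign_def less_2_cases_iff)
  also have "\<dots> = (if \<forall>k\<in>K. i k < 2 then 1 else 0)"
  proof (cases "\<forall>k\<in>K. i k < 2")
    case False
    then obtain k where "k \<in> K" "\<not> i k < 2" by auto
    then have "(\<Prod>k\<in>K. if i k < 2 then 1 else 0 :: real) = 0"
      by (intro prod_zero) (auto simp: K_def)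
    with False show ?thesis by simp
  qed simp
  finally show ?thesis by (simp add: z_def K_def)
qed

text \<open>The coefficients have absolute value one where all indices other than the second are below 2,
  and vanish elsewhere. The absolute values factor as a function of the second index
  times one of the others, so that Minkowski's inequality is an equality as well.\<close>

lemma mixed_norm_sign_form:
  assumes "m \<ge> 2"
  shows "mixed_norm (2 # 1 # replicate (m - 2) 2) (2 ^ (m - 1))
      (\<lambda>js. sign_form m h (\<lambda>k\<in>{..<m}. c0_unit (js ! k))) = 2 ^ (m - 1) * sqrt 2 ^ (m - 1)"
proof -
  define n where "n = m - 2"
  define N :: nat where "N = 2 ^ (m - 1)"
  define a where "a js = sign_form m h (\<lambda>k\<in>{..<m}. c0_unit (js ! k))" for js
  have m: "m - 1 = Suc n" using assms by (simp add: n_def)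
  \<comment> \<open>The summation range must contain the two indices that each coordinate other than 1 uses.\<close>
  have "2 \<le> N" unfolding N_def m by simp
  have square: "(a (i # j # js))\<^sup>2 = (if i < 2 \<and> js \<in> indices 2 n then 1 else 0)"
    if "j < N" "js \<in> indices N n" for i j js
  proof -
    have len: "length js = n" using that by (simp add: indices_def)
    define ix where "ix k = (i # j # js) ! k" for k
    have "(\<lambda>k\<in>{..<m}. c0_unit ((i # j # js) ! k)) = (\<lambda>k\<in>{..<m}. c0_unit (ix k))(1 := c0_unit j)"
      using assms by (auto simp: ix_def fun_eq_iff)
    then have "\<bar>a (i # j # js)\<bar> = (if \<forall>k\<in>{..<m} - {1}. ix k < 2 then 1 else 0)"
      using abs_sign_form_units[of m j h ix] assms that by (simp add: a_def N_def)
    moreover have "(\<forall>k\<in>{..<m} - {1}. ix k < 2) \<longleftrightarrow> i < 2 \<and> js \<in> indices 2 n"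
    proof
      assume L: "\<forall>k\<in>{..<m} - {1}. ix k < 2"
      then have "i < 2" using assms by (auto simp: ix_def dest: bspec[of _ _ 0])
      moreover have "js ! k < 2" if "k < n" for k
        using bspec[OF L, of "k + 2"] that assms by (simp add: ix_def n_def)
      ultimately show "i < 2 \<and> js \<in> indices 2 n"
        using len by (auto simp: indices_def in_set_conv_nth)
    next
      assume R: "i < 2 \<and> js \<in> indices 2 n"
      show "\<forall>k\<in>{..<m} - {1}. ix k < 2"
      proof
        fix k assume "k \<in> {..<m} - {1}"
        then consider "k = 0" | l where "k = Suc (Suc l)" "l < n"
          using assms by (cases k; cases "k - 1") (auto simp: n_def)
        then show "ix k < 2"
          using R len by cases (auto simp: ix_def indices_def subset_iff)
      qed
    qed
    ultimately show ?thesis by (metis (full_types) one_power2 power2_abs zero_power2)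
  qed
  have card: "card (indices 2 n) = 2 ^ n"
    using card_lists_length_eq[of "{..<2 :: nat}" n] by (simp add: indices_def)
  have sub: "indices 2 n \<subseteq> indices N n"
    using \<open>2 \<le> N\<close> by (fastforce simp: indices_def)
  have inner: "L2_set (\<lambda>js. a (i # j # js)) (indices N n) = (if i < 2 then sqrt 2 ^ n else 0)"
    if "j < N" for i j
  proof -
    have "(\<Sum>js\<in>indices N n. (a (i # j # js))\<^sup>2)
        = (\<Sum>js\<in>indices N n. if js \<in> indices 2 n then if i < 2 then 1 else 0 else 0)"
      using square[OF that] by (intro sum.cong) auto
    also have "\<dots> = (if i < 2 then 2 ^ n else 0)"
      using sub by (simp add: sum.inter_restrict[symmetric] finite_indices Int_absorb1 card)
    finally show ?thesis by (simp add: L2_set_def real_sqrt_power)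
  qed
  have "mixed_norm (2 # 1 # replicate n 2) N a
      = L2_set (\<lambda>i. \<Sum>j<N. L2_set (\<lambda>js. a (i # j # js)) (indices N n)) {..<N}"
    by (rule mixed_norm_2_1_2)
  also have "\<dots> = L2_set (\<lambda>i. if i < 2 then real N * sqrt 2 ^ n else 0) {..<N}"
    by (intro L2_set_cong) (auto simp: inner)
  also have "\<dots> = sqrt (\<Sum>i<N. if i < 2 then (real N * sqrt 2 ^ n)\<^sup>2 else 0)"
    unfolding L2_set_def by (intro arg_cong[where f = sqrt] sum.cong) auto
  also have "(\<Sum>i<N. if i < 2 then (real N * sqrt 2 ^ n)\<^sup>2 else 0) = (\<Sum>i\<in>{..<2 :: nat}. (real N * sqrt 2 ^ n)\<^sup>2)"
    using \<open>2 \<le> N\<close> by (intro sum.mono_neutral_cong_right) auto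
  also have "sqrt \<dots> = 2 ^ (m - 1) * sqrt 2 ^ (m - 1)"
    unfolding N_def m by (simp add: real_sqrt_mult)
  finally show ?thesis by (simp add: n_def N_def a_def)
qed

lemma littlewood_constant_ge:
  assumes "m \<ge> 2" and C: "littlewood_constant m (2 # 1 # replicate (m - 2) 2) C"
  shows "2 powr ((real m - 1) / 2) \<le> C"
proof -
  define K where "K = {..<m} - {1}"
  have "card (Pow K) = 2 ^ (m - 1)" using assms by (simp add: K_def card_Pow)
  then obtain h where h: "bij_betw h {..<2 ^ (m - 1) :: nat} (Pow K)"
    using ex_bij_betw_nat_finite[of "Pow K"] by (metis K_def atLeast0LessThan finite_Diff
        finite_Pow_iff finite_lessThan)
  let ?T = "sign_form m h"
  have T: "continuous_multilinear_form m ?T"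
    using assms by (intro continuous_multilinear_sign_form)
  have "2 ^ (m - 1) * sqrt 2 ^ (m - 1) \<le> C * form_norm m ?T"
    using C T mixed_norm_sign_form[OF \<open>m \<ge> 2\<close>, of h]
    unfolding littlewood_constant_def by (metis zero_less_numeral zero_less_power)
  moreover have "0 \<le> form_norm m ?T"
  proof -
    have "(\<lambda>k\<in>{..<m}. 0) \<in> {..<m} \<rightarrow>\<^sub>E cball (0 :: c0) 1" by auto
    from abs_le_form_norm[OF T _ this] show ?thesis using assms by linarith
  qed
  moreover have "form_norm m ?T \<le> 2 ^ (m - 1)"
    using assms h unfolding K_def by (intro form_norm_sign_form_le)
  moreover have "(0 :: real) < 2 ^ (m - 1) * sqrt 2 ^ (m - 1)" by simp
  \<comment> \<open>A negative \<open>C\<close> must be excluded before the bound on the norm can be inserted.\<close>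
  ultimately have "0 < C"
    by (metis less_le_trans not_less mult_nonpos_nonneg not_le)
  then have "C * form_norm m ?T \<le> C * 2 ^ (m - 1)"
    using \<open>form_norm m ?T \<le> 2 ^ (m - 1)\<close> by (intro mult_left_mono) auto
  with \<open>2 ^ (m - 1) * sqrt 2 ^ (m - 1) \<le> C * form_norm m ?T\<close>
  have "2 ^ (m - 1) * sqrt 2 ^ (m - 1) \<le> 2 ^ (m - 1) * C" by (simp only: mult.commute)
  then have "sqrt 2 ^ (m - 1) \<le> C" by (rule mult_left_le_imp_le) simp
  moreover have "sqrt 2 ^ (m - 1) = 2 powr ((real m - 1) / 2)"
    using assms by (intro sqrt_2_power_eq_powr) simp
  ultimately show ?thesis by simp
qed

theorem corollary3p2:
  fixes m :: nat
  assumes "m \<ge> 2"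
  shows "optimal_littlewood_constant m (2 # 1 # replicate (m - 2) 2) (2 powr ((real m - 1) / 2))"
  unfolding optimal_littlewood_constant_def
  using assms by (simp add: littlewood_constant_2_1_2 littlewood_constant_ge)

end
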